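(* Let $t_0\ge 0$, let $\gamma,\delta,\sigma>0$ be constants, let $A\in\mathbb{R}^{m\times n}$, $b\in\mathbb{R}^m$, and let $f:\mathbb{R}^n\to\mathbb{R}\cup\{+\infty\}$ be proper, convex and continuously differentiable. Assume that $\nabla f$ is locally Lipschitz continuous, $\beta>0$ is a constant, and $\gamma\delta>1$. Let $(x(t),\lambda(t))$ be a global solution on $[t_0,+\infty)$ of the dynamical system $$\begin{cases}\ddot x(t)+\gamma\dot x(t)=-\beta\big(\nabla f(x(t))+A^T\lambda(t)+\sigma A^T(Ax(t)-b)\big),\\ \dot\lambda(t)=\beta\big(A(x(t)+\delta\dot x(t))-b\big),\end{cases}$$ and let $(x^*,\lambda^* )\in\Omega$. Then, as $t\to+\infty$, $$|f(\bar x(t))-f(x^* )|=\mathcal{O}\left(\frac1t\right),\qquad \|A\bar x(t)-b\|=\mathcal{O}\left(\frac1t\right),$$ where $\bar x(t)=\frac{1}{t-t_0}\int_{t_0}^t x(s)\,ds$ for $t>t_0$.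
   Context: Norms and inner products are Euclidean. Since $f$ is differentiable on $\mathbb{R}^n$, it is finite everywhere and $\nabla f$ is defined on all of $\mathbb{R}^n$. The underlying problem is $\min_x f(x)$ subject to $Ax=b$, with Lagrangian $\mathcal{L}(x,\lambda)=f(x)+\langle\lambda,Ax-b\rangle$. A pair $(x^*,\lambda^* )\in\mathbb{R}^n\times\mathbb{R}^m$ is a saddle point of $\mathcal{L}$ if $\mathcal{L}(x^*,\lambda)\le\mathcal{L}(x^*,\lambda^* )\le\mathcal{L}(x,\lambda^* )$ for all $(x,\lambda)\in\mathbb{R}^n\times\mathbb{R}^m$; equivalently, $-A^T\lambda^*=\nabla f(x^* )$ and $Ax^*=b$. $\Omega$ denotes the set of saddle points of $\mathcal{L}$. A global solution is a pair with $x\in\mathcal{C}^2([t_0,+\infty),\mathbb{R}^n)$ and $\lambda\in\mathcal{C}^1([t_0,+\infty),\mathbb{R}^m)$ satisfying the system for all $t\ge t_0$. *)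

theory Defs
  imports "HOL-Analysis.Analysis" "HOL-Library.Landau_Symbols"
begin

definition grad :: "('a::euclidean_space \<Rightarrow> real) \<Rightarrow> 'a \<Rightarrow> 'a" where
  "grad f x = (THE D. GDERIV f x :> D)"

lemma GDERIV_grad:
  fixes f :: "'a::euclidean_space \<Rightarrow> real"
  assumes "f differentiable (at x)"
  shows "GDERIV f x :> grad f x"
proof -
  obtain D where D: "(f has_derivative D) (at x)"
    using assms by (auto simp: differentiable_def)
  then have "linear D"
    by (rule has_derivative_linear)
  then have "D = (\<lambda>h. inner h (adjoint D 1))"
    by (simp add: adjoint_works)
  with D have ex: "GDERIV f x :> adjoint D 1"
    by (simp add: gderiv_def)
  have "E = adjoint D 1" if "GDERIV f x :> E" for E
  proof -
    have "(\<lambda>h. inner h E) = (\<lambda>h. inner h (adjoint D 1))"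
      using has_derivative_unique that ex unfolding gderiv_def by blast
    then show ?thesis
      by (metis vector_eq_ldot)
  qed
  with ex show ?thesis
    unfolding grad_def by (rule theI)
qed

definition continuously_differentiable :: "('a::euclidean_space \<Rightarrow> real) \<Rightarrow> bool" where
  "continuously_differentiable f \<longleftrightarrow>
     (\<forall>x. f differentiable (at x)) \<and> continuous_on UNIV (grad f)"

definition lagrangian ::
  "(real^'n \<Rightarrow> real) \<Rightarrow> real^'n^'m \<Rightarrow> real^'m \<Rightarrow> real^'n \<Rightarrow> real^'m \<Rightarrow> real" where
  "lagrangian f A b x l = f x + inner l (A *v x - b)"

definition saddle_points ::
  "(real^'n \<Rightarrow> real) \<Rightarrow> real^'n^'m \<Rightarrow> real^'m \<Rightarrow> ((real^'n) \<times> (real^'m)) set" where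
  "saddle_points f A b = {(xs, ls). \<forall>x l.
     lagrangian f A b xs l \<le> lagrangian f A b xs ls \<and>
     lagrangian f A b xs ls \<le> lagrangian f A b x ls}"

(* Derivatives are taken within the half-line, hence are one-sided at t0; the
   witnesses x', x'', l' are thereby uniquely determined on it. Continuity of x''
   and l' expresses that x is C^2 and l is C^1 on the half-line. *)
definition global_solution ::
  "real \<Rightarrow> real \<Rightarrow> real \<Rightarrow> real \<Rightarrow> real \<Rightarrow> (real^'n \<Rightarrow> real) \<Rightarrow> real^'n^'m \<Rightarrow> real^'m \<Rightarrow>
   (real \<Rightarrow> real^'n) \<Rightarrow> (real \<Rightarrow> real^'m) \<Rightarrow> bool" where
  "global_solution t0 \<gamma> \<delta> \<sigma> \<beta> f A b x l \<longleftrightarrow>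
     (\<exists>x' x'' l'.
        (\<forall>t\<ge>t0. (x has_vector_derivative x' t) (at t within {t0..})) \<and>
        (\<forall>t\<ge>t0. (x' has_vector_derivative x'' t) (at t within {t0..})) \<and>
        (\<forall>t\<ge>t0. (l has_vector_derivative l' t) (at t within {t0..})) \<and>
        continuous_on {t0..} x'' \<and> continuous_on {t0..} l' \<and>
        (\<forall>t\<ge>t0. x'' t + \<gamma> *\<^sub>R x' t =
            - (\<beta> *\<^sub>R (grad f (x t) + transpose A *v l t
                     + \<sigma> *\<^sub>R (transpose A *v (A *v x t - b))))) \<and>
        (\<forall>t\<ge>t0. l' t = \<beta> *\<^sub>R (A *v (x t + \<delta> *\<^sub>R x' t) - b)))"

definition time_average :: "real \<Rightarrow> (real \<Rightarrow> 'a::euclidean_space) \<Rightarrow> real \<Rightarrow> 'a" where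
  "time_average t0 x t = (1 / (t - t0)) *\<^sub>R integral {t0..t} x"

end

(* Put w = x - xs and r = A x - b. Along a trajectory the energy
     |w + \<delta> x'|^2 / 2 + (\<gamma> \<delta> - 1) |w|^2 / 2 + \<delta> |l - ls|^2 / 2
       + \<delta>^2 \<beta> (f x - f xs + <ls, r> + \<sigma> |r|^2 / 2)
   decreases at least at the rate \<delta> \<beta> (f x - f xs + <ls, r>), which is nonnegative at a saddle
   point. Hence x and l stay bounded, and integrating the multiplier equation
   shows that the integral of r is bounded, which is the feasibility rate. The integrated energy
   estimate bounds the integral of f x - f xs + <ls, r>, hence that of f x - f xs; Jensen's
   inequality gives the upper bound on f at the average, and the saddle point inequality
   the lower one. *)
theory Submission
  imports Defs
begin

section \<open>Convexity inequalities and derivatives along curves\<close>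

lemma convex_on_above_gradient:
  fixes f :: "'a::euclidean_space \<Rightarrow> real"
  assumes "convex_on UNIV f" and "f differentiable (at x)"
  shows "f x + inner (grad f x) (y - x) \<le> f y"
proof -
  \<comment> \<open>Restricting \<open>f\<close> to the line from \<open>x\<close> to
    \<open>y\<close> reduces the claim to the one-dimensional tangent inequality between 0 and
    1.\<close>
  define g where "g s = f (x + s *\<^sub>R (y - x))" for s :: real
  have "convex_on UNIV g"
  proof (intro convex_onI)
    fix t a c :: real
    assume "0 < t" "t < 1"
    have eq: "x + ((1 - t) *\<^sub>R a + t *\<^sub>R c) *\<^sub>R (y - x)
        = (1 - t) *\<^sub>R (x + a *\<^sub>R (y - x)) + t *\<^sub>R (x + c *\<^sub>R (y - x))"
      by (simp add: algebra_simps)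
    show "g ((1 - t) *\<^sub>R a + t *\<^sub>R c) \<le> (1 - t) * g a + t * g c"
      unfolding g_def eq using \<open>0 < t\<close> \<open>t < 1\<close> by (intro convex_onD[OF assms(1)]) auto
  qed auto
  moreover have "(g has_real_derivative inner (grad f x) (y - x)) (at 0)"
  proof -
    have f: "(f has_derivative (\<lambda>h. inner h (grad f x))) (at (x + 0 *\<^sub>R (y - x)))"
      using GDERIV_grad[OF assms(2)] by (simp add: gderiv_def)
    have "((\<lambda>s. x + s *\<^sub>R (y - x)) has_derivative (\<lambda>s. s *\<^sub>R (y - x))) (at 0)"
      by (auto intro!: derivative_eq_intros)
    from has_derivative_compose[OF this f] show ?thesis
      unfolding g_def has_field_derivative_def by (simp add: inner_commute mult_commute_abs)
  qed
  ultimately have "g 1 - g 0 \<ge> inner (grad f x) (y - x) * (1 - 0)"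
    by (intro convex_on_imp_above_tangent[where A = UNIV]) auto
  then show ?thesis
    by (simp add: g_def)
qed

lemma has_real_derivative_inner_self:
  fixes u :: "real \<Rightarrow> 'a::real_inner"
  assumes "(u has_vector_derivative u') (at t within S)"
  shows "((\<lambda>t. inner (u t) (u t)) has_real_derivative 2 * inner (u t) u') (at t within S)"
  using bounded_bilinear.has_vector_derivative[OF bounded_bilinear_inner assms assms]
  by (simp add: has_real_derivative_iff_has_vector_derivative inner_commute)

lemma has_real_derivative_compose_grad:
  fixes f :: "'a::euclidean_space \<Rightarrow> real"
  assumes "f differentiable (at (u t))" and "(u has_vector_derivative u') (at t within S)"
  shows "((\<lambda>t. f (u t)) has_real_derivative inner (grad f (u t)) u') (at t within S)"
proof -
  have "(f has_derivative (\<lambda>h. inner h (grad f (u t)))) (at (u t))"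
    using GDERIV_grad[OF assms(1)] by (simp add: gderiv_def)
  from has_derivative_compose[OF assms(2)[unfolded has_vector_derivative_def] this] show ?thesis
    unfolding has_field_derivative_def by (simp add: inner_commute mult_commute_abs)
qed

text \<open>The tangent to \<open>f\<close> at the average lies below \<open>f\<close> and is
  integrated along the curve. Its linear part integrates to zero, because the average is exactly the
  point \<open>m\<close> at which the integral of \<open>x s - m\<close> vanishes.\<close>

lemma jensen_time_average:
  fixes f :: "'a::euclidean_space \<Rightarrow> real"
  assumes f: "convex_on UNIV f" "\<And>y. f differentiable (at y)"
    and x: "continuous_on {t0..t} x" and "t0 < t"
  shows "(t - t0) * f (time_average t0 x t) \<le> integral {t0..t} (\<lambda>s. f (x s))"
proof -
  define m where "m = time_average t0 x t"
  have ix: "(x has_integral (t - t0) *\<^sub>R m) {t0..t}"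
    using integrable_integral[OF integrable_continuous_interval[OF x]] \<open>t0 < t\<close>
    by (simp add: m_def time_average_def)
  have cf: "continuous_on {t0..t} (\<lambda>s. f (x s))"
    using f(2) by (intro continuous_on_compose2[OF _ x, of UNIV])
      (auto intro!: differentiable_imp_continuous_on simp: differentiable_on_def)
  \<comment> \<open>The type of \<open>c\<close> stays generic: the fact is applied both to the
    vector \<open>m\<close> and to the real number \<open>f m\<close>.\<close>
  have c: "((\<lambda>s. c) has_integral (t - t0) *\<^sub>R c) {t0..t}" for c :: "'b::euclidean_space"
    using has_integral_const_real[of c t0 t] \<open>t0 < t\<close> by simp
  have "((\<lambda>s. f m + inner (grad f m) (x s - m)) has_integral
      (t - t0) *\<^sub>R f m + inner (grad f m) ((t - t0) *\<^sub>R m - (t - t0) *\<^sub>R m)) {t0..t}"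
    by (intro has_integral_add c
        has_integral_linear[OF has_integral_diff[OF ix c] bounded_linear_inner_right, unfolded o_def])
  from has_integral_le[OF this integrable_integral[OF integrable_continuous_interval[OF cf]]]
  show ?thesis
    using convex_on_above_gradient[OF f] by (simp add: m_def)
qed

section \<open>Saddle points and the energy estimate\<close>

lemma saddle_points_feasible:
  assumes "(xs, ls) \<in> saddle_points f A b"
  shows "A *v xs = b"
proof -
  \<comment> \<open>Moving the multiplier along the residual of \<open>xs\<close> raises the
    Lagrangian by the squared norm of that residual, so maximality at \<open>ls\<close> forces the
    residual to vanish.\<close>
  have "lagrangian f A b xs (ls + (A *v xs - b)) \<le> lagrangian f A b xs ls"
    using assms by (simp add: saddle_points_def)
  then have "inner (A *v xs - b) (A *v xs - b) \<le> 0"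
    by (simp add: lagrangian_def inner_add_left)
  then show ?thesis
    by (metis eq_iff_diff_eq_0 inner_eq_zero_iff inner_ge_zero order_antisym)
qed

text \<open>By feasibility of \<open>xs\<close>, the expression is the Lagrangian at
  \<open>(y, ls)\<close> minus its value at \<open>(xs, ls)\<close>. This sign is used three times:
  for the lower bound on the energy, for the integrated gap, and for the lower bound on
  \<open>f\<close> at the average.\<close>

lemma saddle_points_lagrangian_gap_nonneg:
  assumes "(xs, ls) \<in> saddle_points f A b"
  shows "0 \<le> f y - f xs + inner ls (A *v y - b)"
proof -
  have "lagrangian f A b xs ls \<le> lagrangian f A b y ls"
    using assms by (simp add: saddle_points_def)
  then show ?thesis
    using saddle_points_feasible[OF assms] by (simp add: lagrangian_def)
qed

text \<open>The arguments \<open>y\<close>, \<open>v\<close>, \<open>k\<close> stand for position,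
  velocity and multiplier. The shift by \<delta> in the first square matches the extrapolated point
  in the multiplier equation, and the last bracket is the gap of the augmented Lagrangian.\<close>

definition energy ::
  "real \<Rightarrow> real \<Rightarrow> real \<Rightarrow> real \<Rightarrow> (real^'n \<Rightarrow> real) \<Rightarrow> real^'n^'m \<Rightarrow> real^'m \<Rightarrow> real^'n \<Rightarrow> real^'m \<Rightarrow>
   real^'n \<Rightarrow> real^'n \<Rightarrow> real^'m \<Rightarrow> real" where
  "energy \<gamma> \<delta> \<sigma> \<beta> f A b xs ls y v k =
     inner (y - xs + \<delta> *\<^sub>R v) (y - xs + \<delta> *\<^sub>R v) / 2
     + (\<gamma> * \<delta> - 1) / 2 * inner (y - xs) (y - xs)
     + \<delta> / 2 * inner (k - ls) (k - ls)
     + \<delta>\<^sup>2 * \<beta> * (f y - f xs + inner ls (A *v y - b) + \<sigma> / 2 * inner (A *v y - b) (A *v y - b))"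

text \<open>The weights of the energy are chosen to cancel every term without a sign. The second
  square removes the product of deviation and velocity, the multiplier square removes the coupling
  through \<open>transpose A\<close>, and the augmented gap removes the products of the velocity
  with the gradient, with the penalty term and with the image of \<open>ls\<close>.\<close>

lemma energy_derivative:
  fixes A :: "real^'n^'m"
  assumes f: "f differentiable (at (x t))"
    and x: "(x has_vector_derivative x' t) (at t within S)"
    and x': "(x' has_vector_derivative x'') (at t within S)"
    and l: "(l has_vector_derivative l') (at t within S)"
    and eqx: "x'' + \<gamma> *\<^sub>R x' t =
            - (\<beta> *\<^sub>R (grad f (x t) + transpose A *v l t
                     + \<sigma> *\<^sub>R (transpose A *v (A *v x t - b))))"
    and eql: "l' = \<beta> *\<^sub>R (A *v (x t + \<delta> *\<^sub>R x' t) - b)"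
    and feas: "A *v xs = b"
  shows "((\<lambda>t. energy \<gamma> \<delta> \<sigma> \<beta> f A b xs ls (x t) (x' t) (l t)) has_real_derivative
      - \<delta> * (\<gamma> * \<delta> - 1) * inner (x' t) (x' t) - \<delta> * \<beta> * inner (grad f (x t)) (x t - xs)
      - \<delta> * \<beta> * \<sigma> * inner (A *v x t - b) (A *v x t - b)
      - \<delta> * \<beta> * inner ls (A *v x t - b)) (at t within S)"
proof -
  define g w v k r Av where defs: "g = grad f (x t)" "w = x t - xs" "v = x' t" "k = l t"
    "r = A *v x t - b" "Av = A *v x' t"
  have x''_eq: "x'' = - (\<gamma> *\<^sub>R v) - \<beta> *\<^sub>R (g + transpose A *v k + \<sigma> *\<^sub>R (transpose A *v r))"
    using eqx by (simp add: defs algebra_simps)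
  have l'_eq: "l' = \<beta> *\<^sub>R (r + \<delta> *\<^sub>R Av)"
    by (simp add: eql defs matrix_vector_right_distrib matrix_vector_mult_scaleR)
  \<comment> \<open>Moving \<open>transpose A\<close> across the inner product leaves only
    \<open>r\<close> and \<open>Av\<close>, the vectors that occur in the multiplier
    equation.\<close>
  have adj: "inner u (transpose A *v y) = inner (A *v u) y" for u y
    using dot_lmul_matrix[of y A u] by (simp add: inner_commute)
  have "A *v w = r"
    using feas by (simp add: defs matrix_vector_mult_diff_distrib)
  then have adj_w: "inner w (transpose A *v y) = inner r y" for y
    by (simp only: adj)
  have adj_v: "inner v (transpose A *v y) = inner Av y" for y
    unfolding adj by (simp add: defs)
  have dz: "((\<lambda>t. x t - xs + \<delta> *\<^sub>R x' t) has_vector_derivative v + \<delta> *\<^sub>R x'') (at t within S)"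
    using x x' by (auto intro!: derivative_eq_intros simp: defs)
  have dw: "((\<lambda>t. x t - xs) has_vector_derivative v) (at t within S)"
    using x by (auto intro!: derivative_eq_intros simp: defs)
  have dk: "((\<lambda>t. l t - ls) has_vector_derivative l') (at t within S)"
    using l by (auto intro!: derivative_eq_intros)
  have dr: "((\<lambda>t. A *v x t - b) has_vector_derivative Av) (at t within S)"
    using bounded_linear.has_vector_derivative[OF matrix_vector_mul_bounded_linear x, of A]
    by (auto intro!: derivative_eq_intros simp: defs)
  have dls: "((\<lambda>t. inner ls (A *v x t - b)) has_real_derivative inner ls Av) (at t within S)"
    using bounded_linear.has_vector_derivative[OF bounded_linear_inner_right dr]
    by (simp add: has_real_derivative_iff_has_vector_derivative)
  note sq = has_real_derivative_inner_self
  \<comment> \<open>The value is written in the shape the differentiation rules produce;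
    \<open>- 0\<close> comes from the constant \<open>f xs\<close>.\<close>
  have "((\<lambda>t. energy \<gamma> \<delta> \<sigma> \<beta> f A b xs ls (x t) (x' t) (l t)) has_real_derivative
      2 * inner (w + \<delta> *\<^sub>R v) (v + \<delta> *\<^sub>R x'') / 2 + (\<gamma> * \<delta> - 1) / 2 * (2 * inner w v)
      + \<delta> / 2 * (2 * inner (k - ls) l')
      + \<delta>\<^sup>2 * \<beta> * (inner g v - 0 + inner ls Av + \<sigma> / 2 * (2 * inner r Av))) (at t within S)"
    unfolding energy_def defs
    by (intro DERIV_add DERIV_diff DERIV_const DERIV_cmult DERIV_cdivide
        sq[OF dz, unfolded defs] sq[OF dw, unfolded defs] sq[OF dk, unfolded defs]
        sq[OF dr, unfolded defs] dls[unfolded defs]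
        has_real_derivative_compose_grad[OF f x])
  also have "2 * inner (w + \<delta> *\<^sub>R v) (v + \<delta> *\<^sub>R x'') / 2 + (\<gamma> * \<delta> - 1) / 2 * (2 * inner w v)
      + \<delta> / 2 * (2 * inner (k - ls) l')
      + \<delta>\<^sup>2 * \<beta> * (inner g v - 0 + inner ls Av + \<sigma> / 2 * (2 * inner r Av))
    = - \<delta> * (\<gamma> * \<delta> - 1) * inner v v - \<delta> * \<beta> * inner g w - \<delta> * \<beta> * \<sigma> * inner r r
      - \<delta> * \<beta> * inner ls r"
    \<comment> \<open>Removing \<open>transpose_matrix_vector\<close> keeps products with
      \<open>transpose A\<close> in the form that \<open>adj_w\<close> and \<open>adj_v\<close>
      rewrite.\<close>
    unfolding x''_eq l'_eq
    by (simp add: inner_add_left inner_add_right inner_diff_left inner_diff_right adj_w adj_v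
          add_divide_distrib diff_divide_distrib del: transpose_matrix_vector)
      (simp add: algebra_simps power2_eq_square inner_commute)
  finally show ?thesis
    by (simp add: defs)
qed

text \<open>In the derivative of the energy, the velocity term and the penalty term have a
  favourable sign and are dropped. The tangent inequality at the current point, evaluated at
  \<open>xs\<close>, turns the gradient term into a difference of values of \<open>f\<close>;
  integrating then gives the claim.\<close>

lemma energy_decrease:
  fixes A :: "real^'n^'m"
  assumes "\<gamma> * \<delta> > 1" "\<delta> > 0" "\<beta> > 0" "\<sigma> > 0"
    and f: "convex_on UNIV f" "\<And>y. f differentiable (at y)"
    and x: "\<And>t. t \<ge> t0 \<Longrightarrow> (x has_vector_derivative x' t) (at t within {t0..})"
    and x': "\<And>t. t \<ge> t0 \<Longrightarrow> (x' has_vector_derivative x'' t) (at t within {t0..})"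
    and l: "\<And>t. t \<ge> t0 \<Longrightarrow> (l has_vector_derivative l' t) (at t within {t0..})"
    and eqx: "\<And>t. t \<ge> t0 \<Longrightarrow> x'' t + \<gamma> *\<^sub>R x' t =
            - (\<beta> *\<^sub>R (grad f (x t) + transpose A *v l t
                     + \<sigma> *\<^sub>R (transpose A *v (A *v x t - b))))"
    and eql: "\<And>t. t \<ge> t0 \<Longrightarrow> l' t = \<beta> *\<^sub>R (A *v (x t + \<delta> *\<^sub>R x' t) - b)"
    and feas: "A *v xs = b" and "t \<ge> t0"
  shows "energy \<gamma> \<delta> \<sigma> \<beta> f A b xs ls (x t) (x' t) (l t)
      + \<delta> * \<beta> * integral {t0..t} (\<lambda>s. f (x s) - f xs + inner ls (A *v x s - b))
      \<le> energy \<gamma> \<delta> \<sigma> \<beta> f A b xs ls (x t0) (x' t0) (l t0)"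
proof -
  define E where "E s = energy \<gamma> \<delta> \<sigma> \<beta> f A b xs ls (x s) (x' s) (l s)" for s
  define E' where "E' s = - \<delta> * (\<gamma> * \<delta> - 1) * inner (x' s) (x' s)
      - \<delta> * \<beta> * inner (grad f (x s)) (x s - xs)
      - \<delta> * \<beta> * \<sigma> * inner (A *v x s - b) (A *v x s - b)
      - \<delta> * \<beta> * inner ls (A *v x s - b)" for s
  define \<phi> where "\<phi> s = f (x s) - f xs + inner ls (A *v x s - b)" for s
  have "(E has_vector_derivative E' s) (at s within {t0..t})" if "s \<in> {t0..t}" for s
  proof -
    have "(E has_real_derivative E' s) (at s within {t0..})"
      unfolding E_def E'_def using that
      by (intro energy_derivative[OF f(2) x x' l eqx eql feas]) auto
    then have "(E has_vector_derivative E' s) (at s within {t0..})"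
      by (simp add: has_real_derivative_iff_has_vector_derivative)
    then show ?thesis
      by (rule has_vector_derivative_within_subset) auto
  qed
  \<comment> \<open>\<open>E'\<close> is integrable as a derivative, by the Henstock-Kurzweil
    fundamental theorem.\<close>
  then have E: "(E' has_integral E t - E t0) {t0..t}"
    using \<open>t \<ge> t0\<close> by (intro fundamental_theorem_of_calculus)
  have cx: "continuous_on {t0..t} x"
    using has_vector_derivative_continuous[OF x]
    by (auto simp: continuous_on_eq_continuous_within intro: continuous_within_subset[of _ "{t0..}"])
  have cf: "continuous_on UNIV f"
    using f(2) by (auto intro!: differentiable_imp_continuous_on simp: differentiable_on_def)
  have "continuous_on {t0..t} \<phi>"
    unfolding \<phi>_def
    by (intro continuous_intros cx continuous_on_compose2[OF cf cx]
        bounded_linear.continuous_on[OF matrix_vector_mul_bounded_linear]) auto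
  then have int\<phi>: "((\<lambda>s. - (\<delta> * \<beta>) * \<phi> s) has_integral - (\<delta> * \<beta>) * integral {t0..t} \<phi>) {t0..t}"
    by (intro has_integral_mult_right integrable_integral integrable_continuous_interval)
  have "E t - E t0 \<le> - (\<delta> * \<beta>) * integral {t0..t} \<phi>"
  proof (rule has_integral_le[OF E int\<phi>])
    fix s assume "s \<in> {t0..t}"
    have "\<delta> * (\<gamma> * \<delta> - 1) * inner (x' s) (x' s) \<ge> 0"
      and "\<delta> * \<beta> * \<sigma> * inner (A *v x s - b) (A *v x s - b) \<ge> 0"
      using assms(1-4) by simp_all
    moreover have "\<delta> * \<beta> * (f (x s) - f xs) \<le> \<delta> * \<beta> * inner (grad f (x s)) (x s - xs)"
      using convex_on_above_gradient[OF f, of "x s" xs] assms(2,3)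
      by (intro mult_left_mono) (auto simp: inner_diff_right)
    ultimately show "E' s \<le> - (\<delta> * \<beta>) * \<phi> s"
      by (simp add: E'_def \<phi>_def algebra_simps)
  qed
  then show ?thesis
    by (simp add: E_def \<phi>_def[abs_def])
qed

section \<open>Convergence rates of the averages\<close>

lemma bigo_inverse_time:
  fixes g :: "real \<Rightarrow> real"
  assumes "\<And>t. t > t0 \<Longrightarrow> (t - t0) * \<bar>g t\<bar> \<le> C"
  shows "g \<in> O[at_top](\<lambda>t. 1 / t)"
\<comment> \<open>Beyond this threshold \<open>t\<close> is positive and \<open>t / 2\<close> is at
  most \<open>t - t0\<close>, which costs the factor 2.\<close>
proof (intro bigoI[of _ "2 * C"] eventually_at_top_linorderI[of "2 * \<bar>t0\<bar> + 1"])
  fix t :: real assume t: "2 * \<bar>t0\<bar> + 1 \<le> t"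
  then have "t / 2 * \<bar>g t\<bar> \<le> (t - t0) * \<bar>g t\<bar>"
    by (intro mult_right_mono) auto
  also have "\<dots> \<le> C"
    using t by (intro assms) auto
  finally show "norm (g t) \<le> 2 * C * norm (1 / t)"
    using t by (simp add: field_simps)
qed

theorem mainTheorem2:
  fixes t0 \<gamma> \<delta> \<sigma> \<beta> :: real
    and A :: "real^'n^'m" and b :: "real^'m"
    and f :: "real^'n \<Rightarrow> real"
    and x :: "real \<Rightarrow> real^'n" and l :: "real \<Rightarrow> real^'m"
    and xs :: "real^'n" and ls :: "real^'m"
  assumes "t0 \<ge> 0"
    and "\<gamma> > 0" and "\<delta> > 0" and "\<sigma> > 0" and "\<beta> > 0"
    and "\<gamma> * \<delta> > 1"
    and "convex_on UNIV f"
    and "continuously_differentiable f"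
    and "local_lipschitz (UNIV :: real set) UNIV (\<lambda>_. grad f)"
    and "global_solution t0 \<gamma> \<delta> \<sigma> \<beta> f A b x l"
    and "(xs, ls) \<in> saddle_points f A b"
  shows "(\<lambda>t. \<bar>f (time_average t0 x t) - f xs\<bar>) \<in> O[at_top](\<lambda>t. 1 / t) \<and>
         (\<lambda>t. norm (A *v time_average t0 x t - b)) \<in> O[at_top](\<lambda>t. 1 / t)"
proof -
  have f: "convex_on UNIV f" and diff: "\<And>y. f differentiable (at y)"
    using assms(7,8) by (auto simp: continuously_differentiable_def)
  obtain x' x'' l' where
    x: "\<And>t. t \<ge> t0 \<Longrightarrow> (x has_vector_derivative x' t) (at t within {t0..})"
    and x': "\<And>t. t \<ge> t0 \<Longrightarrow> (x' has_vector_derivative x'' t) (at t within {t0..})"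
    and l: "\<And>t. t \<ge> t0 \<Longrightarrow> (l has_vector_derivative l' t) (at t within {t0..})"
    and eqx: "\<And>t. t \<ge> t0 \<Longrightarrow> x'' t + \<gamma> *\<^sub>R x' t =
            - (\<beta> *\<^sub>R (grad f (x t) + transpose A *v l t
                     + \<sigma> *\<^sub>R (transpose A *v (A *v x t - b))))"
    and eql: "\<And>t. t \<ge> t0 \<Longrightarrow> l' t = \<beta> *\<^sub>R (A *v (x t + \<delta> *\<^sub>R x' t) - b)"
    using assms(10) unfolding global_solution_def by blast
  have feas: "A *v xs = b"
    using assms(11) by (rule saddle_points_feasible)
  note gap = saddle_points_lagrangian_gap_nonneg[OF assms(11)]
  define r where "r t = A *v x t - b" for t
  define \<phi> where "\<phi> t = f (x t) - f xs + inner ls (r t)" for t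
  define E where "E t = energy \<gamma> \<delta> \<sigma> \<beta> f A b xs ls (x t) (x' t) (l t)" for t
  define B where "B = E t0"
  have cx: "continuous_on {t0..t} x" for t
    using has_vector_derivative_continuous[OF x]
    by (auto simp: continuous_on_eq_continuous_within intro: continuous_within_subset[of _ "{t0..}"])
  have cfx: "continuous_on {t0..t} (\<lambda>s. f (x s))" for t
    using diff by (intro continuous_on_compose2[OF _ cx, of UNIV])
      (auto intro!: differentiable_imp_continuous_on simp: differentiable_on_def)
  have cr: "continuous_on {t0..t} r" for t
    unfolding r_def
    by (intro continuous_intros cx bounded_linear.continuous_on[OF matrix_vector_mul_bounded_linear])
  have decr: "E t + \<delta> * \<beta> * integral {t0..t} \<phi> \<le> B" if "t \<ge> t0" for t
    unfolding E_def B_def \<phi>_def[abs_def] r_def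
    by (rule energy_decrease[OF assms(6,3,5,4) f diff x x' l eqx eql feas that])
  have c\<phi>: "continuous_on {t0..t} \<phi>" for t
    unfolding \<phi>_def by (intro continuous_intros cfx cr)
  have int\<phi>: "integral {t0..t} \<phi> \<ge> 0" for t
    using gap by (intro Henstock_Kurzweil_Integration.integral_nonneg integrable_continuous_interval c\<phi>)
      (simp add: \<phi>_def r_def)
  \<comment> \<open>The shifted square and the augmented gap are both nonnegative and are
    discarded.\<close>
  have E_lower: "(\<gamma> * \<delta> - 1) / 2 * (norm (x t - xs))\<^sup>2 + \<delta> / 2 * (norm (l t - ls))\<^sup>2 \<le> E t" for t
  proof -
    have "0 \<le> \<delta>\<^sup>2 * \<beta> * (f (x t) - f xs + inner ls (A *v x t - b)
        + \<sigma> / 2 * inner (A *v x t - b) (A *v x t - b))"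
      using assms(4,5) gap[of "x t"] by (intro mult_nonneg_nonneg add_nonneg_nonneg[of "_ + _"]) auto
    then show ?thesis
      unfolding E_def energy_def by (simp add: power2_norm_eq_inner)
  qed
  have lower: "(\<gamma> * \<delta> - 1) / 2 * (norm (x t - xs))\<^sup>2 + \<delta> / 2 * (norm (l t - ls))\<^sup>2 \<le> B" if "t \<ge> t0" for t
  proof -
    have "0 \<le> \<delta> * \<beta> * integral {t0..t} \<phi>"
      using int\<phi> assms(3,5) by simp
    then show ?thesis
      using decr[OF that] E_lower[of t] by linarith
  qed
  \<comment> \<open>Dropping either square in \<open>lower\<close> bounds the other, which gives
    radii valid for all times from \<open>t0\<close> on.\<close>
  define X where "X = sqrt (2 * B / (\<gamma> * \<delta> - 1))"
  define L where "L = sqrt (2 * B / \<delta>)"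
  have X: "norm (x t - xs) \<le> X" if "t \<ge> t0" for t
  proof -
    have "\<delta> / 2 * (norm (l t - ls))\<^sup>2 \<ge> 0"
      using assms(3) by simp
    then have "(\<gamma> * \<delta> - 1) / 2 * (norm (x t - xs))\<^sup>2 \<le> B"
      using lower[OF that] by linarith
    then show ?thesis
      unfolding X_def using assms(6) by (intro real_le_rsqrt) (simp add: field_simps)
  qed
  have L: "norm (l t - ls) \<le> L" if "t \<ge> t0" for t
  proof -
    have "(\<gamma> * \<delta> - 1) / 2 * (norm (x t - xs))\<^sup>2 \<ge> 0"
      using assms(6) by simp
    then have "\<delta> / 2 * (norm (l t - ls))\<^sup>2 \<le> B"
      using lower[OF that] by linarith
    then show ?thesis
      unfolding L_def using assms(3) by (intro real_le_rsqrt) (simp add: field_simps)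
  qed
  define K where "K = onorm ((*v) A)"
  have K: "norm (A *v y) \<le> K * norm y" "K \<ge> 0" for y
    unfolding K_def by (auto intro: onorm onorm_pos_le matrix_vector_mul_bounded_linear)
  \<comment> \<open>Two values of \<open>l\<close> contribute \<open>L / \<beta>\<close> each, and
    two values of \<open>x\<close> contribute \<delta> times \<open>K * X\<close> each.\<close>
  define R where "R = 2 * L / \<beta> + \<delta> * (K * (2 * X))"
  have intr: "norm (integral {t0..t} r) \<le> R" if "t \<ge> t0" for t
  proof -
    \<comment> \<open>Divided by \<beta>, the multiplier equation reads: \<open>r\<close> is the
      derivative of this combination. The integral of \<open>r\<close> is thus an increment of a
      bounded function.\<close>
    define q where "q s = (1 / \<beta>) *\<^sub>R l s - \<delta> *\<^sub>R (A *v x s)" for s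
    have "(q has_vector_derivative r s) (at s within {t0..t})" if "s \<in> {t0..t}" for s
    proof -
      have s: "s \<ge> t0" using that by simp
      have "(q has_vector_derivative (1 / \<beta>) *\<^sub>R l' s - \<delta> *\<^sub>R (A *v x' s)) (at s within {t0..})"
        unfolding q_def[abs_def]
        using l[OF s] bounded_linear.has_vector_derivative[OF matrix_vector_mul_bounded_linear x[OF s], of A]
        by (auto intro!: derivative_eq_intros)
      moreover have "(1 / \<beta>) *\<^sub>R l' s - \<delta> *\<^sub>R (A *v x' s) = r s"
        using assms(5) by (simp add: eql[OF s] r_def matrix_vector_right_distrib
            matrix_vector_mult_scaleR algebra_simps)
      ultimately show ?thesis
        by (auto intro: has_vector_derivative_within_subset)
    qed
    then have "integral {t0..t} r = q t - q t0"
      using that by (intro integral_unique fundamental_theorem_of_calculus)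
    \<comment> \<open>Inserting \<open>ls\<close> and \<open>xs\<close> at both ends leaves the
      increment unchanged and makes \<open>L\<close> and \<open>X\<close> applicable.\<close>
    also have "\<dots> = (1 / \<beta>) *\<^sub>R ((l t - ls) - (l t0 - ls)) - \<delta> *\<^sub>R (A *v ((x t - xs) - (x t0 - xs)))"
      by (simp add: q_def matrix_vector_mult_diff_distrib algebra_simps)
    also have "norm \<dots> \<le> norm ((1 / \<beta>) *\<^sub>R ((l t - ls) - (l t0 - ls)))
        + norm (\<delta> *\<^sub>R (A *v ((x t - xs) - (x t0 - xs))))"
      by (rule norm_triangle_ineq4)
    also have "\<dots> \<le> (1 / \<beta>) * (2 * L) + \<delta> * (K * (2 * X))"
    proof (intro add_mono)
      have "norm ((l t - ls) - (l t0 - ls)) \<le> 2 * L"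
        using norm_triangle_ineq4[of "l t - ls" "l t0 - ls"] L[OF that] L[of t0] by simp
      then show "norm ((1 / \<beta>) *\<^sub>R ((l t - ls) - (l t0 - ls))) \<le> (1 / \<beta>) * (2 * L)"
        using assms(5) by (simp add: divide_right_mono)
      have "norm ((x t - xs) - (x t0 - xs)) \<le> 2 * X"
        using norm_triangle_ineq4[of "x t - xs" "x t0 - xs"] X[OF that] X[of t0] by simp
      then have "norm (A *v ((x t - xs) - (x t0 - xs))) \<le> K * (2 * X)"
        using K by (meson mult_left_mono order_trans)
      then show "norm (\<delta> *\<^sub>R (A *v ((x t - xs) - (x t0 - xs)))) \<le> \<delta> * (K * (2 * X))"
        using assms(3) by simp
    qed
    finally show ?thesis
      by (simp add: R_def mult.commute)
  qed
  define m where "m t = time_average t0 x t" for t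
  \<comment> \<open>The residual is affine in \<open>x\<close>, so averaging commutes with it; the
    bound \<open>R\<close> thereby passes to the average.\<close>
  have int_r: "integral {t0..t} r = (t - t0) *\<^sub>R (A *v m t - b)" if "t > t0" for t
  proof -
    have "(x has_integral (t - t0) *\<^sub>R m t) {t0..t}"
      using integrable_integral[OF integrable_continuous_interval[OF cx]] that
      by (simp add: m_def time_average_def)
    from has_integral_linear[OF this matrix_vector_mul_bounded_linear[of A]]
    have "((\<lambda>s. A *v x s - b) has_integral A *v ((t - t0) *\<^sub>R m t) - (t - t0) *\<^sub>R b) {t0..t}"
      using has_integral_const_real[of b t0 t] that
      by (intro has_integral_diff) (auto simp: o_def)
    then show ?thesis
      by (simp add: r_def[abs_def] integral_unique matrix_vector_mult_scaleR scaleR_diff_right)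
  qed
  have Am: "(t - t0) * norm (A *v m t - b) \<le> R" if "t > t0" for t
    using intr[of t] int_r[OF that] that by simp
  \<comment> \<open>The first summand of the bound comes from the energy budget, the second from
    separating the multiplier term from the gap.\<close>
  have fm: "(t - t0) * \<bar>f (m t) - f xs\<bar> \<le> B / (\<delta> * \<beta>) + norm ls * R" if "t > t0" for t
  proof -
    have B_nonneg: "B \<ge> 0"
      using order_trans[OF _ lower[of t0]] assms(3,6) by simp
    have ls: "\<bar>(t - t0) * inner ls (A *v m t - b)\<bar> \<le> norm ls * R"
    proof -
      have "\<bar>(t - t0) * inner ls (A *v m t - b)\<bar> \<le> norm ls * ((t - t0) * norm (A *v m t - b))"
        using Cauchy_Schwarz_ineq2[of ls "A *v m t - b"] that
        by (simp add: abs_mult mult.left_commute)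
      also have "\<dots> \<le> norm ls * R"
        using Am[OF that] by (rule mult_left_mono) simp
      finally show ?thesis .
    qed
    have "integral {t0..t} \<phi> = integral {t0..t} (\<lambda>s. f (x s)) - (t - t0) * f xs
        + inner ls (integral {t0..t} r)"
    proof (rule integral_unique)
      show "(\<phi> has_integral integral {t0..t} (\<lambda>s. f (x s)) - (t - t0) * f xs
          + inner ls (integral {t0..t} r)) {t0..t}"
        unfolding \<phi>_def[abs_def]
        using has_integral_const_real[of "f xs" t0 t] that
        by (intro has_integral_add has_integral_diff integrable_integral integrable_continuous_interval cfx
            has_integral_linear[OF _ bounded_linear_inner_right, unfolded o_def] cr) auto
    qed
    \<comment> \<open>The energy at time \<open>t\<close> is nonnegative, so the accumulated gap
      cannot exceed the initial energy \<open>B\<close>.\<close>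
    moreover have "\<delta> * \<beta> * integral {t0..t} \<phi> \<le> B"
    proof -
      have "0 \<le> E t"
        using order_trans[OF _ E_lower[of t]] assms(3,6) by simp
      then show ?thesis
        using decr[of t] that by simp
    qed
    then have "integral {t0..t} \<phi> \<le> B / (\<delta> * \<beta>)"
      using assms(3,5) by (simp add: field_simps)
    moreover have "(t - t0) * f (m t) \<le> integral {t0..t} (\<lambda>s. f (x s))"
      unfolding m_def using f diff cx that by (rule jensen_time_average)
    ultimately have "(t - t0) * (f (m t) - f xs) + (t - t0) * inner ls (A *v m t - b) \<le> B / (\<delta> * \<beta>)"
      using int_r[OF that] by (simp add: right_diff_distrib)
    \<comment> \<open>The sum of objective and multiplier terms now lies between 0 and
      \<open>B / (\<delta> * \<beta>)\<close>. Since the multiplier term is at most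
      \<open>norm ls * R\<close> in absolute value, the objective term is bounded on both sides;
      nonnegativity of \<open>B\<close> lets one symmetric bound cover the lower side.\<close>
    moreover have "0 \<le> (t - t0) * (f (m t) - f xs) + (t - t0) * inner ls (A *v m t - b)"
      using mult_nonneg_nonneg[OF _ gap[of "m t"], of "t - t0"] that by (simp add: distrib_left)
    moreover have "B / (\<delta> * \<beta>) \<ge> 0"
      using B_nonneg assms(3,5) by simp
    ultimately have "\<bar>(t - t0) * (f (m t) - f xs)\<bar> \<le> B / (\<delta> * \<beta>) + norm ls * R"
      using ls by linarith
    then show ?thesis
      using that by (simp add: abs_mult)
  qed
  have "(\<lambda>t. \<bar>f (m t) - f xs\<bar>) \<in> O[at_top](\<lambda>t. 1 / t)"
    by (rule bigo_inverse_time[of t0 _ "B / (\<delta> * \<beta>) + norm ls * R"]) (simp add: fm)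
  moreover have "(\<lambda>t. norm (A *v m t - b)) \<in> O[at_top](\<lambda>t. 1 / t)"
    by (rule bigo_inverse_time[of t0 _ R]) (simp add: Am)
  ultimately show ?thesis
    by (simp only: m_def)
qed

end
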